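(* Let $n\ge 2$ be an integer and let $\Omega_n\subset\mathbb{R}^{n^3}$ be the polytope of $n\times n\times n$ stochastic tensors. Let $f_0(\Omega_n)$ denote the number of vertices of $\Omega_n$. Then $$f_0(\Omega_n)\le \binom{n^3-\lfloor \frac{(n-1)^3+1}{2}\rfloor}{3n^2-3n+1}+\binom{n^3-\lfloor \frac{(n-1)^3+2}{2}\rfloor}{3n^2-3n+1}.$$
   Context: An $n\times n\times n$ stochastic tensor is a real array $A=(a_{ijk})_{1\le i,j,k\le n}$ with $a_{ijk}\ge 0$ for all $i,j,k$, and $\sum_{i=1}^n a_{ijk}=1$ for all $j,k$, $\sum_{j=1}^n a_{ijk}=1$ for all $i,k$, $\sum_{k=1}^n a_{ijk}=1$ for all $i,j$. The set $\Omega_n$ of all such tensors, viewed as a subset of $\mathbb{R}^{n^3}$, is a convex polytope; its vertices are its extreme points. *)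

theory Defs
  imports "HOL-Analysis.Analysis"
begin

definition stochastic_tensors :: "(real^'n^'n^'n) set" where
  "stochastic_tensors = {A.
     (\<forall>i j k. 0 \<le> A $ i $ j $ k) \<and>
     (\<forall>j k. (\<Sum>i\<in>UNIV. A $ i $ j $ k) = 1) \<and>
     (\<forall>i k. (\<Sum>j\<in>UNIV. A $ i $ j $ k) = 1) \<and>
     (\<forall>i j. (\<Sum>k\<in>UNIV. A $ i $ j $ k) = 1)}"

end

theory Submission
  imports Defs "HOL-Library.Function_Algebras" "HOL-Computational_Algebra.Polynomial"
begin

text \<open>The bound is McMullen's upper bound for a polytope of dimension \<open>d = (n - 1)\<^sup>3\<close> with \<open>N = n\<^sup>3\<close>
  facets, proved in the style of Alon and Kalai. At each vertex \<open>v\<close> choose \<open>d\<close> vanishing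
  coordinates \<open>D v\<close> that form a basis of the linear functionals on the direction space, and expand a
  generic functional \<open>c\<close> in them. Let \<open>A v \<subseteq> D v\<close> be the coordinates with negative coefficient. On the
  face where the coordinates in \<open>A v\<close> vanish, \<open>c\<close> is minimal at \<open>v\<close>. So if \<open>c\<close> is smaller at \<open>u\<close> than
  at \<open>v\<close>, then \<open>A v\<close> meets the complement of \<open>D u\<close>, and the skew version of Bollobas's theorem bounds
  the number of vertices with \<open>card (A v) \<le> p\<close> by \<open>(N - d + p) choose p\<close>. Replacing \<open>c\<close> by \<open>- c\<close> swaps
  the signs, so each vertex has \<open>card (A v) \<le> d div 2\<close> for \<open>c\<close> or \<open>card (A v) \<le> (d - 1) div 2\<close> for \<open>- c\<close>.
  No genericity of the polytope is needed.\<close>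

section \<open>Homogeneous forms as real-valued functions\<close>

interpretation fun_space: vector_space "\<lambda>c (f :: 'a \<Rightarrow> real) x. c * f x"
  by unfold_locales (auto simp: fun_eq_iff algebra_simps)

lemma sum_apply: "(\<Sum>a\<in>A. f a) x = (\<Sum>a\<in>A. f a x :: real)"
  by (induction A rule: infinite_finite_induct) auto

text \<open>The monomials of degree \<open>q\<close> in the variables \<open>x 0\<close>, ...,
  \<open>x p\<close>, taken as functions. The last clause splits them by whether the top variable
  divides them, so that counting follows Pascal's rule.\<close>

fun monomials :: "nat \<Rightarrow> nat \<Rightarrow> ((nat \<Rightarrow> real) \<Rightarrow> real) set" where
  "monomials 0 q = {\<lambda>x. x 0 ^ q}"
| "monomials (Suc p) 0 = {\<lambda>x. 1}"
| "monomials (Suc p) (Suc q) =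
     monomials p (Suc q) \<union> (\<lambda>m x. x (Suc p) * m x) ` monomials (Suc p) q"

lemma monomials_0 [simp]: "monomials p 0 = {\<lambda>x. 1}"
  by (cases p) auto

lemma finite_monomials: "finite (monomials p q)"
  by (induction p q rule: monomials.induct) auto

lemma card_monomials: "card (monomials p q) \<le> (p + q) choose q"
proof (induction p q rule: monomials.induct)
  case (3 p q)
  have "card (monomials (Suc p) (Suc q)) \<le> card (monomials p (Suc q)) + card (monomials (Suc p) q)"
    using card_image_le[OF finite_monomials[of "Suc p" q]]
    by (simp only: monomials.simps) (rule order_trans[OF card_Un_le], rule add_left_mono, blast)
  also have "\<dots> \<le> (p + Suc q choose Suc q) + (Suc p + q choose q)"
    using 3 by linarith
  finally show ?case
    by simp
qed auto

text \<open>If the top variable divides \<open>m\<close>, multiply the cofactor, which has smaller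
  degree, by \<open>x k\<close> and then restore the top variable. Otherwise either
  \<open>x k\<close> is itself the top variable or the claim reduces to fewer variables. Hence the
  induction on \<open>p\<close> with an inner one on \<open>q\<close>.\<close>

lemma monomials_mult:
  assumes "m \<in> monomials p q" "k \<le> p"
  shows "(\<lambda>x. x k * m x) \<in> monomials p (Suc q)"
  using assms
proof (induction p arbitrary: q m)
  case (Suc p)
  note outer_IH = Suc.IH
  show ?case
    using Suc.prems
  proof (induction q arbitrary: m)
    case 0
    then show ?case
      using Suc.IH[of "\<lambda>x. 1" 0] by (cases "k = Suc p") auto
  next
    case (Suc q m)
    consider "k = Suc p" | "k \<le> p" "m \<in> monomials p (Suc q)"
      | m' where "k \<le> Suc p" "m' \<in> monomials (Suc p) q" "m = (\<lambda>x. x (Suc p) * m' x)"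
      using Suc.prems le_Suc_eq by auto
    then show ?case
    proof cases
      case 1
      then show ?thesis
        using Suc.prems by (subst monomials.simps) blast
    next
      case 2
      then show ?thesis
        using outer_IH
        by (subst monomials.simps) blast
    next
      case 3
      then have "(\<lambda>x. x k * m' x) \<in> monomials (Suc p) (Suc q)"
        by (intro Suc.IH)
      then have "(\<lambda>x. x (Suc p) * (x k * m' x)) \<in> monomials (Suc p) (Suc (Suc q))"
        by (subst monomials.simps) (rule UnI2, erule rev_image_eqI, rule refl)
      with 3 show ?thesis
        by (simp add: mult.left_commute)
    qed
  qed
qed auto

lemma linear_form_mult_in_span_monomials:
  assumes "f \<in> fun_space.span (monomials p q)"
  shows "(\<lambda>x. (\<Sum>i\<le>p. c i * x i) * f x) \<in> fun_space.span (monomials p (Suc q))"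
  using assms
proof (induction rule: fun_space.span_induct_alt)
  case base
  then show ?case
    using fun_space.span_zero by (simp add: zero_fun_def)
next
  case (step a m g)
  have "(\<Sum>i\<le>p. (\<lambda>x. c i * (x i * m x))) \<in> fun_space.span (monomials p (Suc q))"
    by (intro fun_space.span_sum fun_space.span_scale fun_space.span_base monomials_mult step) simp
  moreover have "(\<Sum>i\<le>p. (\<lambda>x. c i * (x i * m x))) = (\<lambda>x. (\<Sum>i\<le>p. c i * x i) * m x)"
    by (simp add: fun_eq_iff sum_distrib_right sum_apply mult.assoc)
  ultimately have "(\<lambda>x. a * ((\<Sum>i\<le>p. c i * x i) * m x)) + (\<lambda>x. (\<Sum>i\<le>p. c i * x i) * g x)
      \<in> fun_space.span (monomials p (Suc q))"
    using step by (intro fun_space.span_add fun_space.span_scale) auto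
  then show ?case
    by (simp add: plus_fun_def algebra_simps)
qed

lemma prod_linear_forms_in_span_monomials:
  assumes "finite B"
  shows "(\<lambda>x. \<Prod>b\<in>B. \<Sum>i\<le>p. c b i * x i) \<in> fun_space.span (monomials p (card B))"
  using assms
proof (induction rule: finite_induct)
  case empty
  then show ?case
    by (auto intro: fun_space.span_base)
next
  case (insert b B)
  then show ?case
    using linear_form_mult_in_span_monomials[OF insert.IH] by simp
qed

section \<open>The skew Bollobas inequality by linear independence\<close>

text \<open>Map the ground set into the reals. To \<open>A v\<close> assign the monic polynomial with root set \<open>A v\<close>, and
  to \<open>B v\<close> the functional that multiplies the values of a polynomial at the points of \<open>B v\<close>, a form of
  degree \<open>q\<close> in the \<open>p + 1\<close> coefficients. The matrix of values is triangular with respect to \<open>h\<close>.\<close>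

lemma skew_bollobas:
  fixes A B :: "'v \<Rightarrow> 'k set" and h :: "'v \<Rightarrow> real"
  assumes "finite V" "finite K" "inj_on h V"
    and A: "\<And>v. v \<in> V \<Longrightarrow> A v \<subseteq> K \<and> card (A v) \<le> p"
    and B: "\<And>v. v \<in> V \<Longrightarrow> B v \<subseteq> K \<and> card (B v) = q"
    and disj: "\<And>v. v \<in> V \<Longrightarrow> A v \<inter> B v = {}"
    and meet: "\<And>u v. \<lbrakk>u \<in> V; v \<in> V; h u < h v\<rbrakk> \<Longrightarrow> A v \<inter> B u \<noteq> {}"
  shows "card V \<le> (p + q) choose q"
proof -
  obtain t0 :: "'k \<Rightarrow> nat" where t0: "inj_on t0 K"
    using finite_imp_inj_to_nat_seg[OF \<open>finite K\<close>] by metis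
  define t where "t k = real (t0 k)" for k
  have t: "t a = t b \<longleftrightarrow> a = b" if "a \<in> K" "b \<in> K" for a b
    using t0 that by (auto simp: t_def inj_on_def)
  define P where "P v = (\<Prod>a\<in>A v. [:- t a, 1:])" for v
  define f where "f u x = (\<Prod>b\<in>B u. \<Sum>i\<le>p. t b ^ i * x i)" for u and x :: "nat \<Rightarrow> real"
  have fin: "finite (A v)" "finite (B v)" if "v \<in> V" for v
    using A[OF that] B[OF that] \<open>finite K\<close> by (auto intro: finite_subset)
  have degree_P: "degree (P v) \<le> p" if "v \<in> V" for v
  proof -
    have "degree (P v) \<le> (\<Sum>a\<in>A v. degree [:- t a, 1:])"
      unfolding P_def using degree_prod_sum_le fin that by (metis (lifting) comp_def sum.cong)
    then show ?thesis
      using A[OF that] by simp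
  qed
  have eval: "(\<Sum>i\<le>p. s ^ i * coeff (P v) i) = poly (P v) s" if "v \<in> V" for v s
  proof -
    have "poly (P v) s = (\<Sum>i\<le>p. coeff (P v) i * s ^ i)"
      unfolding poly_altdef using degree_P[OF that]
      by (intro sum.mono_neutral_left) (auto simp: coeff_eq_0)
    then show ?thesis
      by (simp add: mult.commute)
  qed
  have f_P: "f u (coeff (P v)) = 0 \<longleftrightarrow> A v \<inter> B u \<noteq> {}" if "u \<in> V" "v \<in> V" for u v
  proof -
    have "f u (coeff (P v)) = (\<Prod>b\<in>B u. \<Prod>a\<in>A v. t b - t a)"
      unfolding f_def eval[OF that(2)] by (simp add: P_def poly_prod)
    also have "\<dots> = 0 \<longleftrightarrow> (\<exists>b\<in>B u. \<exists>a\<in>A v. t b = t a)"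
      using fin[OF that(1)] fin[OF that(2)] by simp
    also have "\<dots> \<longleftrightarrow> A v \<inter> B u \<noteq> {}"
      using t A[OF that(2)] B[OF that(1)] by blast
    finally show ?thesis .
  qed
  have diag: "f v (coeff (P v)) \<noteq> 0" if "v \<in> V" for v
    using f_P disj that by blast
  have upper: "f u (coeff (P v)) = 0" if "u \<in> V" "v \<in> V" "h u < h v" for u v
    using f_P meet that by blast
  have inj: "inj_on f V"
  proof (rule inj_onI, rule ccontr)
    fix u v assume *: "u \<in> V" "v \<in> V" "f u = f v" "u \<noteq> v"
    then have "h u < h v \<or> h v < h u"
      using \<open>inj_on h V\<close> by (meson inj_onD linorder_neqE)
    then show False
      using * diag upper by metis
  qed
  have indep: "fun_space.independent (f ` V)"
  proof
    assume "fun_space.dependent (f ` V)"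
    then obtain u g where g: "g \<in> f ` V" "u g \<noteq> 0"
      and zero: "(\<Sum>g\<in>f ` V. (\<lambda>x. u g * g x)) = 0"
      using fun_space.dependent_finite[OF finite_imageI[OF \<open>finite V\<close>]] by blast
    \<comment> \<open>In a vanishing nontrivial combination, take \<open>v\<close> in the support
      with \<open>h v\<close> maximal and evaluate at the coefficients of \<open>P v\<close>. Every
      other term of the support has smaller \<open>h\<close> and vanishes by \<open>upper\<close>;
      the diagonal term does not.\<close>
    define W where "W = {v \<in> V. u (f v) \<noteq> 0}"
    have "finite W" "W \<noteq> {}"
      using \<open>finite V\<close> g by (auto simp: W_def)
    then have "Max (h ` W) \<in> h ` W"
      by (intro Max_in) auto
    then obtain v where v: "v \<in> W" "Max (h ` W) = h v"
      by blast
    have max: "h w \<le> h v" if "w \<in> W" for w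
      using \<open>finite W\<close> that by (simp flip: v(2))
    have "0 = (\<Sum>g\<in>f ` V. (\<lambda>x. u g * g x)) (coeff (P v))"
      by (simp add: zero)
    also have "\<dots> = (\<Sum>g\<in>f ` V. u g * g (coeff (P v)))"
      by (simp add: sum_apply)
    also have "\<dots> = (\<Sum>g\<in>{f v}. u g * g (coeff (P v)))"
    proof (rule sum.mono_neutral_right)
      show "\<forall>g\<in>f ` V - {f v}. u g * g (coeff (P v)) = 0"
      proof
        fix g assume g: "g \<in> f ` V - {f v}"
        then obtain w where w: "w \<in> V" "g = f w" "w \<noteq> v"
          by blast
        show "u g * g (coeff (P v)) = 0"
        proof (cases "w \<in> W")
          case True
          then have "h w < h v"
            using max[OF True] v w \<open>inj_on h V\<close> by (auto simp: W_def inj_on_def order_less_le)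
          then show ?thesis
            using upper v w by (simp add: W_def)
        qed (use w g in \<open>auto simp: W_def\<close>)
      qed
    qed (use \<open>finite V\<close> v in \<open>auto simp: W_def\<close>)
    finally show False
      using diag v by (simp add: W_def)
  qed
  have "f ` V \<subseteq> fun_space.span (monomials p q)"
  proof (rule image_subsetI)
    fix v assume v: "v \<in> V"
    have "f v = (\<lambda>x. \<Prod>b\<in>B v. \<Sum>i\<le>p. t b ^ i * x i)"
      by (simp add: f_def fun_eq_iff)
    then have "f v \<in> fun_space.span (monomials p (card (B v)))"
      using prod_linear_forms_in_span_monomials[OF fin(2)[OF v], of "\<lambda>b i. t b ^ i" p] by simp
    then show "f v \<in> fun_space.span (monomials p q)"
      using B[OF v] by simp
  qed
  then have "card (f ` V) \<le> card (monomials p q)"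
    using fun_space.independent_span_bound[OF finite_monomials indep] by blast
  then show ?thesis
    using card_monomials[of p q] card_image[OF inj] by linarith
qed

section \<open>Vertices of an affine subspace intersected with the nonnegative orthant\<close>

text \<open>Small moves from \<open>v\<close> along \<open>w\<close> and \<open>- w\<close> keep the
  zero coordinates zero and the positive ones nonnegative. For nonzero \<open>w\<close> this makes
  \<open>v\<close> the midpoint of a segment in the polyhedron.\<close>

lemma extreme_point_orthogonal_coordinates:
  fixes L :: "'a::euclidean_space set"
  assumes L: "subspace L"
    and v: "v extreme_point_of {x. x - a \<in> L \<and> (\<forall>b\<in>Basis. 0 \<le> x \<bullet> b)}"
    and w: "w \<in> L" "\<And>b. \<lbrakk>b \<in> Basis; v \<bullet> b = 0\<rbrakk> \<Longrightarrow> w \<bullet> b = 0"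
  shows "w = 0"
proof (rule ccontr)
  assume "w \<noteq> 0"
  let ?P = "{x. x - a \<in> L \<and> (\<forall>b\<in>Basis. 0 \<le> x \<bullet> b)}"
  have vP: "v - a \<in> L" "\<And>b. b \<in> Basis \<Longrightarrow> 0 \<le> v \<bullet> b"
    using v by (auto simp: extreme_point_of_def)
  \<comment> \<open>The \<open>+ 1\<close> keeps the denominators positive, and inserting
    \<open>1\<close> makes the set nonempty even if all coordinates of \<open>v\<close>
    vanish.\<close>
  define e where "e = Min (insert 1 ((\<lambda>b. v \<bullet> b / (\<bar>w \<bullet> b\<bar> + 1)) ` {b \<in> Basis. v \<bullet> b \<noteq> 0}))"
  have "e > 0"
    unfolding e_def using vP(2) by (subst Min_gr_iff) (auto simp: order_less_le add_nonneg_eq_0_iff)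
  have e: "e * \<bar>w \<bullet> b\<bar> \<le> v \<bullet> b" if b: "b \<in> Basis" for b
  proof (cases "v \<bullet> b = 0")
    case False
    then have "e \<le> v \<bullet> b / (\<bar>w \<bullet> b\<bar> + 1)"
      unfolding e_def using b by (intro Min_le) auto
    then have "e * \<bar>w \<bullet> b\<bar> + e \<le> v \<bullet> b"
      by (simp add: field_simps)
    with \<open>e > 0\<close> show ?thesis
      by linarith
  qed (use w b in simp)
  have P: "v + s *\<^sub>R w \<in> ?P" if "\<bar>s\<bar> = e" for s
  proof -
    have "(v - a) + s *\<^sub>R w \<in> L"
      using L vP w by (intro subspace_add subspace_scale)
    moreover have "0 \<le> (v + s *\<^sub>R w) \<bullet> b" if b: "b \<in> Basis" for b
    proof -
      have "\<bar>s * (w \<bullet> b)\<bar> \<le> v \<bullet> b"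
        using e[OF b] \<open>\<bar>s\<bar> = e\<close> by (simp add: abs_mult)
      then show ?thesis
        by (simp add: inner_add_left)
    qed
    ultimately show ?thesis
      by (simp add: algebra_simps)
  qed
  have "v + e *\<^sub>R w \<noteq> v + (- e) *\<^sub>R w"
    using \<open>e > 0\<close> \<open>w \<noteq> 0\<close> unfolding add_left_cancel scaleR_cancel_right by linarith
  moreover have "midpoint (v + e *\<^sub>R w) (v + (- e) *\<^sub>R w) = v"
    by (simp add: midpoint_def flip: scaleR_2)
  ultimately have "v \<in> open_segment (v + e *\<^sub>R w) (v + (- e) *\<^sub>R w)"
    by (metis midpoint_in_open_segment)
  then show False
    using v P[of e] P[of "- e"] \<open>e > 0\<close> unfolding extreme_point_of_def by force
qed

text \<open>By the previous lemma the coordinate vectors vanishing at \<open>v\<close>, together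
  with the orthogonal complement of \<open>L\<close>, span the space. Extend a basis
  \<open>C\<close> of the complement to a basis \<open>M\<close> by such coordinate vectors;
  \<open>M - C\<close> then gives a basis of the functionals on \<open>L\<close>.\<close>

lemma extreme_point_coordinate_basis:
  fixes L :: "'a::euclidean_space set"
  assumes L: "subspace L"
    and v: "v extreme_point_of {x. x - a \<in> L \<and> (\<forall>b\<in>Basis. 0 \<le> x \<bullet> b)}"
  obtains D where "D \<subseteq> Basis" "card D = dim L" "\<And>b. b \<in> D \<Longrightarrow> v \<bullet> b = 0"
    "\<And>c. \<exists>l. \<forall>x\<in>L. c \<bullet> x = (\<Sum>b\<in>D. l b * (x \<bullet> b))"
proof -
  define Z where "Z = {b \<in> Basis. v \<bullet> b = 0}"
  obtain C where C: "C \<subseteq> L\<^sup>\<bottom>" "independent C" "L\<^sup>\<bottom> \<subseteq> span C" "card C = dim (L\<^sup>\<bottom>)"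
    using basis_exists by blast
  obtain M where M: "C \<subseteq> M" "M \<subseteq> C \<union> Z" "independent M" "C \<union> Z \<subseteq> span M"
    using maximal_independent_subset_extend[of C "C \<union> Z"] C(2) by auto
  have "span M = UNIV"
  proof (rule ccontr)
    assume "span M \<noteq> UNIV"
    then obtain w where w: "w \<noteq> 0" "\<And>x. x \<in> span M \<Longrightarrow> orthogonal w x"
      using span_not_UNIV_orthogonal[of M] by (auto simp: orthogonal_def)
    have "L\<^sup>\<bottom> \<subseteq> span M"
      using C(3) M(1) span_mono by blast
    then have "w \<in> L\<^sup>\<bottom>\<^sup>\<bottom>"
      using w(2) by (auto simp: orthogonal_comp_def orthogonal_commute)
    then have "w \<in> L"
      by (simp add: orthogonal_comp_self[OF L])
    moreover have "w \<bullet> b = 0" if "b \<in> Basis" "v \<bullet> b = 0" for b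
      using w(2)[of b] M(4) that by (auto simp: Z_def orthogonal_def)
    ultimately show False
      using extreme_point_orthogonal_coordinates[OF L v] w(1) by blast
  qed
  have "card M = DIM('a)" "finite M"
    using \<open>span M = UNIV\<close> M(3) by (metis dim_UNIV dim_span dim_eq_card_independent)
      (use M(3) independent_imp_finite in blast)
  have "dim (L\<^sup>\<bottom>) + dim L = DIM('a)"
    using dim_subspace_orthogonal_to_vectors[OF L subspace_UNIV] by (simp add: orthogonal_comp_def)
  show ?thesis
  proof
    show "M - C \<subseteq> Basis" "\<And>b. b \<in> M - C \<Longrightarrow> v \<bullet> b = 0"
      using M(2) by (auto simp: Z_def)
    show "card (M - C) = dim L"
      using \<open>card M = DIM('a)\<close> \<open>finite M\<close> C(4) M(1) \<open>dim (L\<^sup>\<bottom>) + dim L = DIM('a)\<close>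
      by (simp add: card_Diff_subset finite_subset)
    fix c :: 'a
    have "c \<in> span (C \<union> (M - C))"
      using \<open>span M = UNIV\<close> M(1) by (simp add: Un_absorb1)
    \<comment> \<open>The component \<open>s\<close> is orthogonal to \<open>L\<close>, so on
      \<open>L\<close> only \<open>r\<close> contributes.\<close>
    then obtain s r where c: "c = s + r" "s \<in> span C" "r \<in> span (M - C)"
      unfolding span_Un by blast
    obtain l where r: "r = (\<Sum>b\<in>M - C. l b *\<^sub>R b)"
      using c(3) \<open>finite M\<close> by (auto simp: span_finite)
    have "s \<in> L\<^sup>\<bottom>"
      using c(2) C(1) span_minimal subspace_orthogonal_comp by blast
    have "c \<bullet> x = (\<Sum>b\<in>M - C. l b * (x \<bullet> b))" if "x \<in> L" for x
    proof -
      have "x \<bullet> s = 0"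
        using \<open>s \<in> L\<^sup>\<bottom>\<close> that by (simp add: orthogonal_comp_def orthogonal_def)
      then have "s \<bullet> x = 0"
        by (subst inner_commute)
      then have "c \<bullet> x = (\<Sum>b\<in>M - C. l b * (b \<bullet> x))"
        by (simp add: c(1) r inner_add_left inner_sum_left)
      then show ?thesis
        by (simp only: inner_commute)
    qed
    then show "\<exists>l. \<forall>x\<in>L. c \<bullet> x = (\<Sum>b\<in>M - C. l b * (x \<bullet> b))"
      by blast
  qed
qed

section \<open>Generic functionals and the vertex count\<close>

text \<open>The functionals that identify two given distinct points form a hyperplane, and finitely
  many hyperplanes do not cover the space.\<close>

lemma exists_inj_inner:
  fixes V :: "'a::euclidean_space set"
  assumes "finite V"
  obtains c where "inj_on (\<lambda>v. c \<bullet> v) V"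
proof -
  define H where "H = (\<Union>(u, v)\<in>V \<times> V - Id. {c. (u - v) \<bullet> c = 0})"
  have "negligible H"
    unfolding H_def using assms by (intro negligible_Union) (auto intro!: negligible_hyperplane)
  then have "H \<noteq> UNIV"
    using non_negligible_UNIV by metis
  then obtain c where "c \<notin> H"
    by blast
  have "inj_on (\<lambda>v. c \<bullet> v) V"
  proof (rule inj_onI, rule ccontr)
    fix u v assume "u \<in> V" "v \<in> V" "c \<bullet> u = c \<bullet> v" "u \<noteq> v"
    then have "(u, v) \<in> V \<times> V - Id" "(u - v) \<bullet> c = 0"
      by (auto simp: inner_commute[of _ c] inner_diff_right)
    with \<open>c \<notin> H\<close> show False
      unfolding H_def by blast
  qed
  then show thesis
    using that by blast
qed

lemma card_extreme_points_le:
  fixes L :: "'a::euclidean_space set"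
  assumes L: "subspace L"
  shows "card {v. v extreme_point_of {x. x - a \<in> L \<and> (\<forall>b\<in>Basis. 0 \<le> x \<bullet> b)}}
    \<le> (dim L div 2 + (DIM('a) - dim L) choose (DIM('a) - dim L))
     + ((dim L - 1) div 2 + (DIM('a) - dim L) choose (DIM('a) - dim L))"
    (is "card {v. v extreme_point_of ?P} \<le> (?lo + ?q choose ?q) + (?hi + ?q choose ?q)")
proof (cases "finite {v. v extreme_point_of ?P}")
  case True
  define V where "V = {v. v extreme_point_of ?P}"
  let ?good = "\<lambda>v D. D \<subseteq> Basis \<and> card D = dim L \<and> (\<forall>b\<in>D. v \<bullet> b = 0) \<and>
      (\<forall>c. \<exists>l. \<forall>x\<in>L. c \<bullet> x = (\<Sum>b\<in>D. l b * (x \<bullet> b)))"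
  have "\<forall>v\<in>V. \<exists>D. ?good v D"
  proof
    fix v assume "v \<in> V"
    then have "v extreme_point_of ?P"
      by (simp add: V_def)
    from extreme_point_coordinate_basis[OF L this] obtain D where
      "D \<subseteq> Basis" "card D = dim L" "\<And>b. b \<in> D \<Longrightarrow> v \<bullet> b = 0"
      "\<And>c. \<exists>l. \<forall>x\<in>L. c \<bullet> x = (\<Sum>b\<in>D. l b * (x \<bullet> b))"
      by blast
    then show "\<exists>D. ?good v D"
      by (intro exI[of _ D]) simp
  qed
  from bchoice[OF this] obtain D where good: "\<forall>v\<in>V. ?good v (D v)" ..
  have D: "D v \<subseteq> Basis" "card (D v) = dim L" "\<And>b. b \<in> D v \<Longrightarrow> v \<bullet> b = 0" if "v \<in> V" for v
    using good that by auto
  obtain c where c: "inj_on (\<lambda>v. c \<bullet> v) V"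
    using exists_inj_inner True unfolding V_def by blast
  have "\<forall>v\<in>V. \<exists>l. \<forall>x\<in>L. c \<bullet> x = (\<Sum>b\<in>D v. l b * (x \<bullet> b))"
    using good by simp
  from bchoice[OF this] obtain l
    where l: "\<forall>v\<in>V. \<forall>x\<in>L. c \<bullet> x = (\<Sum>b\<in>D v. l v b * (x \<bullet> b))" ..
  have finD: "finite (D v)" if "v \<in> V" for v
    by (rule finite_subset[OF D(1)[OF that] finite_Basis])
  \<comment> \<open>The sign \<open>s\<close> treats \<open>c\<close> and \<open>- c\<close>
    together. Zero coefficients fall in neither \<open>neg 1 v\<close> nor
    \<open>neg (- 1) v\<close>.\<close>
  define neg where "neg s v = {b \<in> D v. s * l v b < 0}" for s v
  have bound: "card {v \<in> V. card (neg s v) \<le> p} \<le> (p + ?q) choose ?q"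
    if "s \<noteq> 0" for s :: real and p
  proof (rule skew_bollobas[where h = "\<lambda>v. s * (c \<bullet> v)" and K = Basis
        and A = "neg s" and B = "\<lambda>v. Basis - D v"])
    show "inj_on (\<lambda>v. s * (c \<bullet> v)) {v \<in> V. card (neg s v) \<le> p}"
      using c \<open>s \<noteq> 0\<close> by (auto simp: inj_on_def)
    show "Basis - D v \<subseteq> Basis \<and> card (Basis - D v) = ?q"
      if "v \<in> {v \<in> V. card (neg s v) \<le> p}" for v
      using that D(1,2) finD by (simp add: card_Diff_subset)
    fix u v
    assume u: "u \<in> {v \<in> V. card (neg s v) \<le> p}"
      and v: "v \<in> {v \<in> V. card (neg s v) \<le> p}"
      and less: "s * (c \<bullet> u) < s * (c \<bullet> v)"
    have "u \<in> ?P" "v \<in> ?P"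
      using u v by (auto simp: V_def extreme_point_of_def)
    then have "u - v \<in> L"
      using subspace_diff[OF L, of "u - a" "v - a"] by auto
    then have "c \<bullet> (u - v) = (\<Sum>b\<in>D v. l v b * ((u - v) \<bullet> b))"
      using l v by blast
    also have "\<dots> = (\<Sum>b\<in>D v. l v b * (u \<bullet> b))"
      using D(3)[of v] v by (intro sum.cong) (simp_all add: inner_diff_left)
    finally have "s * (c \<bullet> (u - v)) = (\<Sum>b\<in>D v. (s * l v b) * (u \<bullet> b))"
      by (simp add: sum_distrib_left mult.assoc)
    moreover have "s * (c \<bullet> (u - v)) < 0"
      using less by (simp add: inner_diff_right right_diff_distrib)
    ultimately have "(\<Sum>b\<in>D v. (s * l v b) * (u \<bullet> b)) < 0"
      by simp
    \<comment> \<open>A negative sum has a negative term. As \<open>u\<close> is nonnegative, its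
      coefficient is negative and \<open>u \<bullet> b\<close> is positive, so \<open>b\<close> lies
      in \<open>neg s v\<close> but not in \<open>D u\<close>.\<close>
    then obtain b where b: "b \<in> D v" "(s * l v b) * (u \<bullet> b) < 0"
      by (meson sum_nonneg linorder_not_less)
    moreover have "0 \<le> u \<bullet> b"
      using \<open>u \<in> ?P\<close> D(1) v b by blast
    ultimately have "s * l v b < 0" "u \<bullet> b \<noteq> 0"
      by (auto simp: mult_less_0_iff)
    then show "neg s v \<inter> (Basis - D u) \<noteq> {}"
      using b D(1)[of v] D(3)[of u b] u v by (auto simp: neg_def)
  next
    show "neg s v \<subseteq> Basis \<and> card (neg s v) \<le> p" if "v \<in> {v \<in> V. card (neg s v) \<le> p}" for v
      using that D(1)[of v] by (auto simp: neg_def)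
    show "neg s v \<inter> (Basis - D v) = {}" for v
      by (auto simp: neg_def)
  qed (use True in \<open>auto simp: V_def\<close>)
  \<comment> \<open>The two sets are disjoint inside \<open>D v\<close>. If both bounds failed,
    their sizes would add up to at least \<open>dim L + 1\<close>.\<close>
  have "card (neg 1 v) \<le> ?lo \<or> card (neg (- 1) v) \<le> ?hi"
    if "v \<in> V" for v
  proof -
    have "card (neg 1 v) + card (neg (- 1) v)
        = card (neg 1 v \<union> neg (- 1) v)"
      using finD[OF that] by (intro card_Un_disjoint[symmetric]) (auto simp: neg_def)
    also have "\<dots> \<le> card (D v)"
      using finD[OF that] by (intro card_mono) (auto simp: neg_def)
    finally show ?thesis
      using D(2)[OF that] by linarith
  qed
  then have "V = {v \<in> V. card (neg 1 v) \<le> ?lo} \<union> {v \<in> V. card (neg (- 1) v) \<le> ?hi}"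
    by blast
  from arg_cong[OF this, of card]
  have "card V \<le> card {v \<in> V. card (neg 1 v) \<le> ?lo} + card {v \<in> V. card (neg (- 1) v) \<le> ?hi}"
    using card_Un_le by (rule ord_eq_le_trans)
  then show ?thesis
    using bound[of 1 ?lo] bound[of "- 1" ?hi] by (simp flip: V_def)
next
  case False \<comment> \<open>excluded in fact, but \<open>card\<close> of an infinite set is \<open>0\<close>\<close>
  then show ?thesis
    by simp
qed

section \<open>Stochastic tensors in standard form and their dimension\<close>

text \<open>The direction space of the affine subspace cut out by the line-sum equations.\<close>

definition line_sum_kernel :: "(real^'n^'n^'n) set" where
  "line_sum_kernel = {A.
     (\<forall>j k. (\<Sum>i\<in>UNIV. A $ i $ j $ k) = 0) \<and>
     (\<forall>i k. (\<Sum>j\<in>UNIV. A $ i $ j $ k) = 0) \<and>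
     (\<forall>i j. (\<Sum>k\<in>UNIV. A $ i $ j $ k) = 0)}"

lemma subspace_line_sum_kernel: "subspace line_sum_kernel"
  by (auto simp: subspace_def line_sum_kernel_def sum.distrib simp flip: sum_distrib_left)

text \<open>Puts the polytope into the form required by the vertex bound: inner products with the
  standard basis read off the entries.\<close>

lemma stochastic_tensors_eq:
  assumes "a \<in> stochastic_tensors"
  shows "stochastic_tensors = {A. A - a \<in> line_sum_kernel \<and> (\<forall>b\<in>Basis. 0 \<le> A \<bullet> b)}"
proof -
  have "(\<forall>b\<in>Basis. 0 \<le> A \<bullet> b) \<longleftrightarrow> (\<forall>i j k. 0 \<le> A $ i $ j $ k)" for A :: "real^'n^'n^'n"
    by (auto simp: Basis_vec_def inner_axis)
  then show ?thesis
    using assms by (auto simp: stochastic_tensors_def line_sum_kernel_def sum_subtractf)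
qed

text \<open>The differences \<open>e\<^sub>i - e\<^sub>z\<close> for \<open>i \<noteq> z\<close> are a basis of the vectors with zero sum; their threefold
  tensor products are a basis of the kernel, dual to the coordinates that avoid the index \<open>z\<close>.\<close>

lemma dim_line_sum_kernel: "dim (line_sum_kernel :: (real^'n^'n^'n) set) = (CARD('n) - 1) ^ 3"
proof -
  define z :: 'n where "z = undefined"
  define I where "I = UNIV - {z}"
  define d :: "'n \<Rightarrow> 'n \<Rightarrow> real" where "d p i = of_bool (i = p) - of_bool (i = z)" for p i
  define T :: "'n \<times> 'n \<times> 'n \<Rightarrow> real^'n^'n^'n"
    where "T = (\<lambda>(p, q, r). \<chi> i j k. d p i * d q j * d r k)"
  define K where "K = I \<times> I \<times> I"
  have T_nth: "T t $ i $ j $ k = of_bool (t = (i, j, k))"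
    if "t \<in> K" "(i, j, k) \<in> K" for t i j k
    using that by (auto simp: T_def K_def I_def d_def)
  have sum_d: "(\<Sum>i\<in>UNIV. d p i) = 0" for p
    by (simp add: d_def sum_subtractf of_bool_def)
  have T_kernel: "T t \<in> line_sum_kernel" for t
  proof -
    have "(\<Sum>i\<in>UNIV. d p i * x * y) = 0" "(\<Sum>j\<in>UNIV. x * d p j * y) = 0" "(\<Sum>k\<in>UNIV. x * y * d p k) = 0"
      for p x y
      using sum_d[of p] by (simp_all flip: sum_distrib_left sum_distrib_right)
    then show ?thesis
      by (simp add: T_def line_sum_kernel_def split: prod.splits)
  qed
  have inj: "inj_on T K"
  proof (rule inj_onI)
    fix s t assume st: "s \<in> K" "t \<in> K" "T s = T t"
    obtain i j k where s: "s = (i, j, k)"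
      by (cases s)
    have "T t $ i $ j $ k = 1"
      using T_nth[of s i j k] st s by simp
    then show "s = t"
      using T_nth[of t i j k] st s by (simp split: if_splits)
  qed
  \<comment> \<open>Duality recovers the coefficients of a combination from its entries on
    \<open>K\<close>; this serves both independence and spanning.\<close>
  have comb_nth: "(\<Sum>t\<in>K. c t *\<^sub>R T t) $ i $ j $ k = c (i, j, k)" if "(i, j, k) \<in> K" for c i j k
  proof -
    have "(\<Sum>t\<in>K. c t *\<^sub>R T t) $ i $ j $ k = (\<Sum>t\<in>K. c t * of_bool (t = (i, j, k)))"
      using that by (simp add: T_nth)
    also have "\<dots> = c (i, j, k)"
      using that by (subst sum.remove[of _ "(i, j, k)"]) (auto intro!: sum.neutral)
    finally show ?thesis .
  qed
  have "independent (T ` K)"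
  proof (rule independent_if_scalars_zero)
    fix u x assume u: "(\<Sum>x\<in>T ` K. u x *\<^sub>R x) = 0" and x: "x \<in> T ` K"
    have zero: "(\<Sum>t\<in>K. u (T t) *\<^sub>R T t) = 0"
      using u by (simp add: sum.reindex[OF inj])
    from x obtain i j k where "x = T (i, j, k)" "(i, j, k) \<in> K"
      by auto
    then show "u x = 0"
      using comb_nth[of i j k "\<lambda>t. u (T t)"] unfolding zero by simp
  qed simp
  moreover have "line_sum_kernel \<subseteq> span (T ` K)"
  proof
    fix A :: "real^'n^'n^'n"
    assume A: "A \<in> line_sum_kernel"
    \<comment> \<open>\<open>S\<close> agrees with \<open>A\<close> on all index triples avoiding
      \<open>z\<close>, so it remains to see that a kernel element vanishing there is zero.\<close>
    define S where "S = (\<Sum>t\<in>K. (case t of (i, j, k) \<Rightarrow> A $ i $ j $ k) *\<^sub>R T t)"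
    have S_span: "S \<in> span (T ` K)"
      unfolding S_def by (intro span_sum span_scale span_base imageI)
    define W where "W = A - S"
    have "S \<in> line_sum_kernel"
      unfolding S_def by (intro subspace_sum subspace_scale subspace_line_sum_kernel T_kernel)
    then have W: "W \<in> line_sum_kernel"
      unfolding W_def using A by (intro subspace_diff subspace_line_sum_kernel)
    have W_I: "W $ i $ j $ k = 0" if "i \<in> I" "j \<in> I" "k \<in> I" for i j k
      using comb_nth[of i j k "\<lambda>(i, j, k). A $ i $ j $ k"] that
      by (simp add: W_def S_def K_def)
    \<comment> \<open>A zero-sum vector vanishing off \<open>z\<close> also vanishes at
      \<open>z\<close>. Applied to \<open>i\<close>, \<open>j\<close> and \<open>k\<close> in turn,
      this removes the restrictions on the indices one by one.\<close>
    have all: "x i = 0" if "(\<Sum>i\<in>UNIV. x i) = 0" "\<And>i. i \<in> I \<Longrightarrow> x i = 0" for x :: "'n \<Rightarrow> real" and i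
      using that by (cases "i = z") (auto simp: I_def sum.remove[of UNIV z])
    have W1: "W $ i $ j $ k = 0" if "j \<in> I" "k \<in> I" for i j k
      by (rule all[of "\<lambda>i. W $ i $ j $ k"]) (use W W_I that in \<open>auto simp: line_sum_kernel_def\<close>)
    have W2: "W $ i $ j $ k = 0" if "k \<in> I" for i j k
      by (rule all[of "\<lambda>j. W $ i $ j $ k"]) (use W W1 that in \<open>auto simp: line_sum_kernel_def\<close>)
    have "W $ i $ j $ k = 0" for i j k
      by (rule all[of "\<lambda>k. W $ i $ j $ k"]) (use W W2 in \<open>auto simp: line_sum_kernel_def\<close>)
    then have "W = 0"
      by (simp add: vec_eq_iff)
    then show "A \<in> span (T ` K)"
      using S_span by (simp add: W_def)
  qed
  moreover have "T ` K \<subseteq> line_sum_kernel"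
    using T_kernel by blast
  ultimately have "dim (line_sum_kernel :: (real^'n^'n^'n) set) = card (T ` K)"
    by (intro basis_card_eq_dim[symmetric])
  also have "\<dots> = card K"
    by (rule card_image[OF inj])
  also have "\<dots> = (CARD('n) - 1) ^ 3"
    by (simp add: K_def I_def card_cartesian_product power3_eq_cube mult.assoc)
  finally show ?thesis .
qed

theorem theorem2:
  assumes "CARD('n) \<ge> 2"
  shows "card {A :: real^'n^'n^'n. A extreme_point_of stochastic_tensors}
    \<le> ((CARD('n)^3 - ((CARD('n) - 1)^3 + 1) div 2) choose (3 * CARD('n)^2 - 3 * CARD('n) + 1))
     + ((CARD('n)^3 - ((CARD('n) - 1)^3 + 2) div 2) choose (3 * CARD('n)^2 - 3 * CARD('n) + 1))"
proof -
  define n where "n = CARD('n)"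
  define d where "d = (n - 1) ^ 3"
  define q where "q = 3 * n ^ 2 - 3 * n + 1"
  have "n \<ge> 2"
    using assms by (simp add: n_def)
  then have "d \<ge> 1"
    by (simp add: d_def)
  \<comment> \<open>Writing \<open>n\<close> as a successor turns \<open>n - 1\<close> into
    \<open>m\<close>, so the cubic identity below can be expanded over the naturals.\<close>
  obtain m where n: "n = Suc m"
    using \<open>n \<ge> 2\<close> by (cases n) auto
  have N: "n ^ 3 = d + q"
    by (simp add: d_def q_def n power2_eq_square power3_eq_cube algebra_simps)
  \<comment> \<open>The constant tensor is a base point for the affine description.\<close>
  define a :: "real^'n^'n^'n" where "a = (\<chi> i j k. 1 / CARD('n))"
  have "a \<in> stochastic_tensors"
    by (simp add: a_def stochastic_tensors_def)
  then have "stochastic_tensors = {A. A - a \<in> line_sum_kernel \<and> (\<forall>b\<in>Basis. 0 \<le> A \<bullet> b)}"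
    by (rule stochastic_tensors_eq)
  moreover have "DIM(real^'n^'n^'n) = n ^ 3"
    by (simp add: n_def power3_eq_cube)
  ultimately have "card {A :: real^'n^'n^'n. A extreme_point_of stochastic_tensors}
      \<le> (d div 2 + (n ^ 3 - d) choose (n ^ 3 - d)) + ((d - 1) div 2 + (n ^ 3 - d) choose (n ^ 3 - d))"
    using card_extreme_points_le[OF subspace_line_sum_kernel, of a]
    by (simp only: dim_line_sum_kernel n_def d_def)
  also have "n ^ 3 - d = q"
    using N by simp
  \<comment> \<open>Here \<open>(d + 1) div 2\<close> is \<open>d\<close> halved and rounded up,
    leaving \<open>d div 2\<close>. Likewise \<open>(d + 2) div 2\<close> leaves
    \<open>(d - 1) div 2\<close>, where \<open>d \<ge> 1\<close> excludes truncation.\<close>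
  also have "d div 2 + q = n ^ 3 - (d + 1) div 2"
    using N by linarith
  also have "(d - 1) div 2 + q = n ^ 3 - (d + 2) div 2"
    using N \<open>d \<ge> 1\<close> by linarith
  finally show ?thesis
    by (simp only: n_def d_def q_def)
qed

end
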